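(* Let $X=\{0,1\}$. Let $A$ be an automorphism of the binary rooted tree $X^*$ given by a finite initial Mealy automaton, of bounded activity and acting transitively on every level, and let $B$ be an endomorphism of the binary rooted tree given by a finite initial Mealy automaton. For $w\in X^n$ let $d(w)\in\{0,1,\dots,2^{n}-1\}$ be the unique integer with $A^{d(w)}(w)=B(w)$ (so the class of $d(w)$ modulo $2^n$ is $\mathrm{Log}_{A,n}(B)(w)$). Let $$S_{A,B}=\{(B|_w,\;A^{d(w)}|_w,\;A^{2^{|w|}}|_w) : w\in X^*\}$$ and consider the automaton $\mathcal L=\mathcal L_{A,B}$ with input and output alphabet $X$, set of states $S_{A,B}$, initial state $(B,\mathbf 1,A)$, transition function $\pi((\beta,\gamma,\delta),a)=(\beta',\gamma',\delta')$, where $$\beta'=\beta|_a,\qquad \gamma'=\begin{cases}\gamma|_a & \text{if }\beta(a)=\gamma(a),\\ (\gamma\delta)|_a&\text{otherwise,}\end{cases}\qquad \delta'=\delta^2|_a,$$ and output function $\lambda((\beta,\gamma,\delta),a)=0$ if $\beta(a)=\gamma(a)$ and $\lambda((\beta,\gamma,\delta),a)=1$ otherwise ($a\in X$). Then the transition function is well defined (it takes values in $S_{A,B}$), and for every $n$ and every $w\in X^n$, $$\mathrm{Log}_{A,n}(B)(w)=\Big[\sum_{i=0}^{n-1}\mathcal L(w)_i\,2^i\Big]_{2^n}\in\mathbb Z/2^n\mathbb Z,$$ where $\mathcal L(w)_i$ is the $i$-th character of the word $\mathcal L(w)$ (numbering from $0$).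
   Context: $X^*$ is the set of finite words over $X$, viewed as the vertices of the rooted tree in which $w$ is adjacent to $wa$ for $a\in X$; level $n$ is the set $X^n$ of words of length $n$. An endomorphism of the tree is a map $g:X^*\to X^*$ preserving word length and adjacency; an automorphism is an invertible endomorphism; $\mathbf 1$ is the identity. Products are compositions: $gh=g\circ h$. The section $g|_w$ of $g$ at a word $w$ is the endomorphism defined by $g(wv)=g(w)\,g|_w(v)$ for all words $v$. A finite initial Mealy automaton with input and output alphabet $X$ has a finite state set $S$, an initial state $q$, a transition map $\pi:S\times X\to S$ and an output map $\lambda:S\times X\to X$, extended to words by $\pi(s,xw)=\pi(\pi(s,x),w)$, $\lambda(s,xw)=\lambda(s,x)\lambda(\pi(s,x),w)$; it acts on words by $w\mapsto\lambda(q,w)$, and this endomorphism is the one "given by" the automaton. For an automaton $\mathcal L$, $\mathcal L(w)$ denotes the output word on input $w$. $A$ has bounded activity if there is a constant $c$ such that for every $n$ the number of words $w\in X^n$ with $A|_w\neq\mathbf 1$ is less than $c$. $A$ acts transitively on level $n$ if for all $w_1,w_2\in X^n$ there is an integer $k$ with $A^k(w_1)=w_2$; such $k$ is then unique modulo $2^n$. $\mathrm{Log}_{A,n}(B):X^n\to\mathbb Z/2^n\mathbb Z$ sends $w$ to the class $[k]_{2^n}$ of any integer $k$ with $A^k(w)=B(w)$. *)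

theory Defs
  imports "HOL-Algebra.IntRing"
begin

section \<open>Endomorphisms of the rooted tree of words\<close>

text \<open>
  The alphabet is a type, so the vertices of the tree are the values of the list type; the first
  letter of a word is the head of the list. The binary alphabet is \<^typ>\<open>bool\<close>, with
  \<^term>\<open>False\<close> for the letter 0 and \<^term>\<open>True\<close> for the letter 1.
\<close>

definition tree_adj :: "'a list \<Rightarrow> 'a list \<Rightarrow> bool" where
  "tree_adj u v \<longleftrightarrow> (\<exists>a. v = u @ [a] \<or> u = v @ [a])"

definition tree_endo :: "('a list \<Rightarrow> 'a list) \<Rightarrow> bool" where
  "tree_endo g \<longleftrightarrow>
     (\<forall>w. length (g w) = length w) \<and> (\<forall>u v. tree_adj u v \<longrightarrow> tree_adj (g u) (g v))"

definition tree_auto :: "('a list \<Rightarrow> 'a list) \<Rightarrow> bool" where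
  "tree_auto g \<longleftrightarrow> tree_endo g \<and> (\<exists>h. tree_endo h \<and> g \<circ> h = id \<and> h \<circ> g = id)"

text \<open>The section at \<open>w\<close>; see \<open>section_unique\<close> below for its defining equation.\<close>

definition section_at :: "('a list \<Rightarrow> 'a list) \<Rightarrow> 'a list \<Rightarrow> 'a list \<Rightarrow> 'a list" where
  "section_at g w v = drop (length w) (g (w @ v))"

lemma tree_endo_snoc:
  assumes "tree_endo g"
  shows "\<exists>b. g (w @ [a]) = g w @ [b]"
proof -
  have "tree_adj w (w @ [a])"
    by (auto simp: tree_adj_def)
  then have adj: "tree_adj (g w) (g (w @ [a]))"
    using assms by (auto simp: tree_endo_def)
  have len: "length (g (w @ [a])) = Suc (length (g w))"
    using assms by (simp add: tree_endo_def)
  from adj obtain b where "g (w @ [a]) = g w @ [b] \<or> g w = g (w @ [a]) @ [b]"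
    unfolding tree_adj_def by blast
  then show ?thesis
  proof
    assume "g w = g (w @ [a]) @ [b]"
    from arg_cong[OF this, of length] len show ?thesis by simp
  qed blast
qed

lemma tree_endo_section_at:
  assumes "tree_endo g"
  shows "g (w @ v) = g w @ section_at g w v"
proof -
  have "\<exists>u. g (w @ v) = g w @ u"
  proof (induction v rule: rev_induct)
    case (snoc a v)
    then obtain u where u: "g (w @ v) = g w @ u" by blast
    obtain b where "g ((w @ v) @ [a]) = g (w @ v) @ [b]"
      using tree_endo_snoc[OF assms] by blast
    with u show ?case by simp
  qed simp
  moreover have "length (g w) = length w"
    using assms by (simp add: tree_endo_def)
  ultimately show ?thesis by (auto simp: section_at_def)
qed

lemma section_unique:
  assumes "tree_endo g"
  shows "(\<forall>v. g (w @ v) = g w @ h v) \<longleftrightarrow> h = section_at g w"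
  using tree_endo_section_at[OF assms, of w] by (auto simp: fun_eq_iff)

text \<open>Integer powers; for negative exponents this is meant for bijective \<open>g\<close> only.\<close>

definition fun_powi :: "('b \<Rightarrow> 'b) \<Rightarrow> int \<Rightarrow> 'b \<Rightarrow> 'b" where
  "fun_powi g k = (if 0 \<le> k then g ^^ nat k else inv_into UNIV g ^^ nat (- k))"

definition bounded_activity :: "('a::finite list \<Rightarrow> 'a list) \<Rightarrow> bool" where
  "bounded_activity g \<longleftrightarrow>
     (\<exists>c. \<forall>n. card {w. length w = n \<and> section_at g w \<noteq> id} < c)"

definition level_transitive :: "('a list \<Rightarrow> 'a list) \<Rightarrow> nat \<Rightarrow> bool" where
  "level_transitive g n \<longleftrightarrow>
     (\<forall>w1 w2. length w1 = n \<longrightarrow> length w2 = n \<longrightarrow> (\<exists>k. fun_powi g k w1 = w2))"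

section \<open>Initial Mealy automata\<close>

record ('s, 'a) mealy =
  states :: "'s set"
  init_state :: 's
  transition :: "'s \<Rightarrow> 'a \<Rightarrow> 's"
  outp :: "'s \<Rightarrow> 'a \<Rightarrow> 'a"

text \<open>The transition and output functions are total on the type of states, but only their values on
  \<^const>\<open>states\<close> matter; well-definedness is closure of that set under transitions.\<close>

definition mealy_automaton :: "('s, 'a) mealy \<Rightarrow> bool" where
  "mealy_automaton M \<longleftrightarrow>
     init_state M \<in> states M \<and> (\<forall>s\<in>states M. \<forall>a. transition M s a \<in> states M)"

definition finite_mealy_automaton :: "('s, 'a) mealy \<Rightarrow> bool" where
  "finite_mealy_automaton M \<longleftrightarrow> mealy_automaton M \<and> finite (states M)"

primrec output_word :: "('s, 'a) mealy \<Rightarrow> 's \<Rightarrow> 'a list \<Rightarrow> 'a list" where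
  "output_word M s [] = []"
| "output_word M s (a # w) = outp M s a # output_word M (transition M s a) w"

definition mealy_map :: "('s, 'a) mealy \<Rightarrow> 'a list \<Rightarrow> 'a list" where
  "mealy_map M w = output_word M (init_state M) w"

section \<open>Logarithms and the logarithm automaton\<close>

text \<open>\<^term>\<open>ZMod m k\<close> is the class of \<open>k\<close> in the quotient of the integers by the
  ideal generated by \<open>m\<close>. The definite description is meaningful when all the integers \<open>k\<close>
  in question exist and lie in one class.\<close>

definition Log :: "(bool list \<Rightarrow> bool list) \<Rightarrow> nat \<Rightarrow> (bool list \<Rightarrow> bool list) \<Rightarrow> bool list \<Rightarrow> int set" where
  "Log A n B w = (THE c. \<exists>k. fun_powi A k w = B w \<and> c = ZMod (2 ^ n) k)"

definition log_rep :: "(bool list \<Rightarrow> bool list) \<Rightarrow> (bool list \<Rightarrow> bool list) \<Rightarrow> bool list \<Rightarrow> nat" where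
  "log_rep A B w = (THE d. d < 2 ^ length w \<and> (A ^^ d) w = B w)"

type_synonym log_state =
  "(bool list \<Rightarrow> bool list) \<times> (bool list \<Rightarrow> bool list) \<times> (bool list \<Rightarrow> bool list)"

definition log_states :: "(bool list \<Rightarrow> bool list) \<Rightarrow> (bool list \<Rightarrow> bool list) \<Rightarrow> log_state set" where
  "log_states A B =
     {(section_at B w, section_at (A ^^ log_rep A B w) w, section_at (A ^^ (2 ^ length w)) w) | w. True}"

definition log_transition :: "log_state \<Rightarrow> bool \<Rightarrow> log_state" where
  "log_transition = (\<lambda>(\<beta>, \<gamma>, \<delta>) a.
     (section_at \<beta> [a],
      if \<beta> [a] = \<gamma> [a] then section_at \<gamma> [a] else section_at (\<gamma> \<circ> \<delta>) [a],
      section_at (\<delta> \<circ> \<delta>) [a]))"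

definition log_output :: "log_state \<Rightarrow> bool \<Rightarrow> bool" where
  "log_output = (\<lambda>(\<beta>, \<gamma>, \<delta>) a. if \<beta> [a] = \<gamma> [a] then False else True)"

definition log_automaton ::
  "(bool list \<Rightarrow> bool list) \<Rightarrow> (bool list \<Rightarrow> bool list) \<Rightarrow> (log_state, bool) mealy" where
  "log_automaton A B =
     \<lparr>states = log_states A B, init_state = (B, id, A),
      transition = log_transition, outp = log_output\<rparr>"

end

theory Submission
  imports Defs
begin

text \<open>
  Transitivity makes \<open>A\<close> act on level \<open>n\<close> as a single cycle of length \<open>2 ^ n\<close>, so the section of
  \<open>A ^^ (2 ^ n)\<close> at a word \<open>w\<close> of length \<open>n\<close> swaps the two letters: otherwise some word of length
  \<open>n + 1\<close> would have period \<open>2 ^ n\<close>. Hence extending \<open>w\<close> by a letter either keeps the exponent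
  \<open>d w\<close> or adds \<open>2 ^ n\<close> to it, according to whether the sections of \<open>B\<close> and \<open>A ^^ d w\<close> at \<open>w\<close>
  agree on that letter. So the automaton outputs the binary digits of \<open>d w\<close>, least significant
  first, and after reading \<open>w\<close> it is in the state belonging to \<open>w\<close>.
\<close>

section \<open>Orbits of integer powers\<close>

text \<open>For negative \<open>k\<close>, put \<open>m = - k\<close> and
  \<open>r = k mod p\<close>. Then \<open>p\<close> divides \<open>m + r\<close>, so applying
  \<open>f ^^ m\<close> to \<open>(f ^^ r) x\<close> and to the inverse power of \<open>x\<close>
  gives \<open>x\<close> both times, and injectivity cancels \<open>f ^^ m\<close>.\<close>

lemma fun_powi_eq_funpow_mod:
  assumes "bij f" "0 < p" "(f ^^ p) x = x"
  shows "fun_powi f k x = (f ^^ nat (k mod int p)) x"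
proof (cases "0 \<le> k")
  case True
  then have "nat (k mod int p) = nat k mod p"
    by (simp add: nat_mod_distrib)
  then show ?thesis
    using True funpow_mod_eq[OF assms(3)] by (simp add: fun_powi_def)
next
  case False
  define m where "m = nat (- k)"
  define r where "r = nat (k mod int p)"
  have "int (m + r) = k mod int p - k"
    using False assms(2) by (simp add: m_def r_def)
  then have "int p dvd int (m + r)"
    by (metis dvd_minus_iff minus_diff_eq dvd_minus_mod)
  then have "p dvd m + r"
    using int_dvd_int_iff by blast
  then have "(f ^^ (m + r)) x = x"
    using funpow_mod_eq[OF assms(3), of "m + r"] by simp
  then have "(f ^^ m) ((f ^^ r) x) = (f ^^ m) ((inv_into UNIV f ^^ m) x)"
    using fn_o_inv_fn_is_id[OF assms(1), of m]
    by (simp add: funpow_add fun_eq_iff)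
  then have "(f ^^ r) x = (inv_into UNIV f ^^ m) x"
    using inj_fn[OF bij_is_inj[OF assms(1)], of m] by (simp add: inj_eq)
  then show ?thesis
    using False by (simp add: fun_powi_def m_def r_def)
qed

text \<open>Finiteness of \<open>S\<close> forces a repetition among the iterates, hence a least
  positive period \<open>p\<close>. Minimality makes the first \<open>p\<close> iterates distinct,
  and reducing integer exponents modulo \<open>p\<close> shows that they exhaust \<open>S\<close>;
  so \<open>p = card S\<close>.\<close>

lemma funpow_orbit:
  assumes "bij f" "finite S" "x \<in> S" "f ` S \<subseteq> S"
    and trans: "\<And>y. y \<in> S \<Longrightarrow> \<exists>k. fun_powi f k x = y"
  shows "(f ^^ card S) x = x" and "bij_betw (\<lambda>i. (f ^^ i) x) {..<card S} S"
proof -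
  have in_S: "(f ^^ i) x \<in> S" for i
    by (induction i) (use assms(3,4) in auto)
  have cancel: "(f ^^ (j - i)) x = x" if "i < j" "(f ^^ i) x = (f ^^ j) x" for i j
  proof -
    have "(f ^^ i) ((f ^^ (j - i)) x) = (f ^^ i) x"
      using that funpow_add[of i "j - i" f] by simp
    then show ?thesis
      using inj_fn[OF bij_is_inj[OF assms(1)], of i] by (simp add: inj_eq)
  qed
  have "\<not> inj (\<lambda>i. (f ^^ i) x)"
  proof
    assume "inj (\<lambda>i. (f ^^ i) x)"
    then have "infinite (range (\<lambda>i. (f ^^ i) x))"
      using finite_imageD infinite_UNIV_nat by blast
    moreover have "range (\<lambda>i. (f ^^ i) x) \<subseteq> S"
      using in_S by blast
    ultimately show False
      using assms(2) finite_subset by blast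
  qed
  then obtain i j where "i < j" "(f ^^ i) x = (f ^^ j) x"
    unfolding inj_def by (metis linorder_neqE_nat)
  then have ex: "\<exists>q>0. (f ^^ q) x = x"
    using cancel by (meson zero_less_diff)
  define p where "p = (LEAST q. 0 < q \<and> (f ^^ q) x = x)"
  have p: "0 < p" "(f ^^ p) x = x"
    using LeastI_ex[OF ex] by (auto simp: p_def)
  have p_min: "p \<le> q" if "0 < q" "(f ^^ q) x = x" for q
    using that by (auto simp: p_def intro: Least_le)
  have "inj_on (\<lambda>i. (f ^^ i) x) {..<p}"
  proof (rule linorder_inj_onI)
    fix i j assume "i < j" "i \<in> {..<p}" "j \<in> {..<p}"
    then show "(f ^^ i) x \<noteq> (f ^^ j) x"
      using cancel[of i j] p_min[of "j - i"] by auto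
  qed auto
  moreover have "S \<subseteq> (\<lambda>i. (f ^^ i) x) ` {..<p}"
  proof
    fix y assume "y \<in> S"
    then obtain k where "fun_powi f k x = y"
      using trans by blast
    then have "y = (f ^^ nat (k mod int p)) x"
      using fun_powi_eq_funpow_mod[OF assms(1) p] by simp
    moreover have "nat (k mod int p) < p"
      using p(1) by (simp add: nat_less_iff)
    ultimately show "y \<in> (\<lambda>i. (f ^^ i) x) ` {..<p}"
      by blast
  qed
  ultimately have bij: "bij_betw (\<lambda>i. (f ^^ i) x) {..<p} S"
    using in_S by (auto simp: bij_betw_def)
  then have "card S = p"
    using bij_betw_same_card by fastforce
  then show "(f ^^ card S) x = x" "bij_betw (\<lambda>i. (f ^^ i) x) {..<card S} S"
    using p bij by auto
qed

section \<open>Tree endomorphisms and sections\<close>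

lemma tree_endo_comp: "tree_endo g \<Longrightarrow> tree_endo h \<Longrightarrow> tree_endo (g \<circ> h)"
  by (simp add: tree_endo_def)

lemma tree_endo_funpow: "tree_endo g \<Longrightarrow> tree_endo (g ^^ k)"
  by (induction k) (simp_all add: tree_endo_def)

lemma tree_auto_bij: "tree_auto g \<Longrightarrow> bij g"
  unfolding tree_auto_def using o_bij by blast

lemma section_at_Nil: "section_at g [] = g"
  by (simp add: section_at_def fun_eq_iff)

lemma section_at_append: "section_at g (w @ v) = section_at (section_at g w) v"
  by (simp add: section_at_def fun_eq_iff add.commute)

text \<open>The chain rule for sections: since \<open>h\<close> preserves length, dropping
  \<open>length w\<close> letters removes exactly the image under \<open>g\<close> of the prefix
  \<open>h w\<close>.\<close>

lemma section_at_comp: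
  assumes "tree_endo g" "tree_endo h"
  shows "section_at (g \<circ> h) w = section_at g (h w) \<circ> section_at h w"
proof -
  have "length (h w) = length w"
    using assms(2) by (simp add: tree_endo_def)
  then show ?thesis
    using tree_endo_section_at[OF assms(2), of w]
    by (simp add: section_at_def[of "g \<circ> h"] section_at_def[of g] fun_eq_iff)
qed

section \<open>The logarithm automaton\<close>

lemma card_bool_words: "card {w :: bool list. length w = n} = 2 ^ n"
  using card_lists_length_eq[of "UNIV :: bool set" n] by simp

lemma finite_bool_words: "finite {w :: bool list. length w = n}"
  using finite_lists_length_eq[of "UNIV :: bool set" n] by simp

text \<open>States are indexed by words because different words may yield the same triple;
  transitions are then followed along words.\<close>

definition log_state_at ::
  "(bool list \<Rightarrow> bool list) \<Rightarrow> (bool list \<Rightarrow> bool list) \<Rightarrow> bool list \<Rightarrow> log_state" where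
  "log_state_at A B w =
     (section_at B w, section_at (A ^^ log_rep A B w) w, section_at (A ^^ (2 ^ length w)) w)"

text \<open>The free \<open>n\<close> is generalised, so transitivity is assumed on every
  level.\<close>

locale level_transitive_pair =
  fixes A B :: "bool list \<Rightarrow> bool list"
  assumes auto: "tree_auto A" and transitive: "level_transitive A n" and endo: "tree_endo B"
begin

lemma endo_funpow: "tree_endo (A ^^ k)"
  using auto by (simp add: tree_auto_def tree_endo_funpow)

lemma length_funpow: "length ((A ^^ k) w) = length w"
  using endo_funpow by (simp add: tree_endo_def)

lemma length_B: "length (B w) = length w"
  using endo by (simp add: tree_endo_def)

lemma cycle:
  shows funpow_period: "(A ^^ (2 ^ length w)) w = w"
    and bij_betw_orbit:
      "bij_betw (\<lambda>i. (A ^^ i) w) {..<2 ^ length w} {v. length v = length w}"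
proof -
  let ?S = "{v :: bool list. length v = length w}"
  have "A ` ?S \<subseteq> ?S"
    using length_funpow[of 1] by auto
  moreover have "\<exists>k. fun_powi A k w = v" if "v \<in> ?S" for v
    using that transitive[of "length w"] by (auto simp: level_transitive_def)
  ultimately show "(A ^^ (2 ^ length w)) w = w"
    "bij_betw (\<lambda>i. (A ^^ i) w) {..<2 ^ length w} ?S"
    using funpow_orbit[OF tree_auto_bij[OF auto] finite_bool_words, of w "length w"]
    by (simp_all add: card_bool_words)
qed

lemma funpow_cong:
  assumes "i < 2 ^ length w" "j < 2 ^ length w" "(A ^^ i) w = (A ^^ j) w"
  shows "i = j"
  using assms bij_betw_orbit[of w] by (auto simp: bij_betw_def inj_on_def)

lemma log_rep_eqI:
  assumes "d < 2 ^ length w" "(A ^^ d) w = B w"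
  shows "log_rep A B w = d"
  unfolding log_rep_def using assms funpow_cong by (intro the_equality) auto

lemma log_rep: "log_rep A B w < 2 ^ length w" "(A ^^ log_rep A B w) w = B w"
proof -
  have "B w \<in> (\<lambda>i. (A ^^ i) w) ` {..<2 ^ length w}"
    using bij_betw_orbit[of w] length_B by (simp add: bij_betw_def)
  then obtain d where "d < 2 ^ length w" "(A ^^ d) w = B w"
    by auto
  then show "log_rep A B w < 2 ^ length w" "(A ^^ log_rep A B w) w = B w"
    using log_rep_eqI by auto
qed

text \<open>Any admissible integer exponent, reduced modulo the period, must equal
  \<open>log_rep A B w\<close> by uniqueness, so the definite description in \<open>Log\<close>
  picks out a single class.\<close>

lemma Log_eq: "Log A (length w) B w = ZMod (2 ^ length w) (int (log_rep A B w))"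
proof -
  let ?N = "2 ^ length w :: int"
  have mod: "fun_powi A k w = (A ^^ nat (k mod ?N)) w" for k
    using fun_powi_eq_funpow_mod[OF tree_auto_bij[OF auto] _ funpow_period, of w k] by simp
  have "fun_powi A (int (log_rep A B w)) w = B w"
    using log_rep by (simp add: fun_powi_def)
  moreover have "ZMod ?N k = ZMod ?N (int (log_rep A B w))" if "fun_powi A k w = B w" for k
  proof -
    have "nat (k mod ?N) < 2 ^ length w"
      by (simp add: nat_less_iff)
    then have "nat (k mod ?N) = log_rep A B w"
      using log_rep_eqI[of "nat (k mod ?N)" w] that mod by simp
    then have "k mod ?N = int (log_rep A B w)"
      by (metis int_nat_eq pos_mod_sign zero_less_numeral zero_less_power)
    then have "k mod ?N = int (log_rep A B w) mod ?N"
      by (metis mod_mod_trivial)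
    then show ?thesis
      by (simp add: ZMod_eq_mod)
  qed
  ultimately show ?thesis
    unfolding Log_def by (intro the_equality) blast+
qed

lemma section_period_flip: "section_at (A ^^ (2 ^ length w)) w [a] = [\<not> a]"
proof -
  let ?g = "A ^^ (2 ^ length w)"
  have eq: "?g (w @ [a]) = w @ section_at ?g w [a]"
    using tree_endo_section_at[OF endo_funpow] funpow_period by metis
  \<comment> \<open>One level deeper, all exponents below \<open>2 ^ (length w + 1)\<close> give
    distinct images, so \<open>2 ^ length w\<close> is not yet a return time of
    \<open>w @ [a]\<close>.\<close>
  have "?g (w @ [a]) \<noteq> (A ^^ 0) (w @ [a])"
    using funpow_cong[of "2 ^ length w" "w @ [a]" 0] by auto
  then have "section_at ?g w [a] \<noteq> [a]"
    using eq by auto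
  moreover have "length (section_at ?g w [a]) = 1"
    by (simp add: section_at_def length_funpow)
  ultimately show ?thesis
    by (auto simp: length_Suc_conv)
qed

lemma funpow_period_snoc: "(A ^^ (2 ^ length w)) (w @ [a]) = w @ [\<not> a]"
  using tree_endo_section_at[OF endo_funpow] funpow_period section_period_flip by metis

text \<open>Both the old exponent and its sum with \<open>2 ^ length w\<close> are below
  \<open>2 ^ length (w @ [a])\<close>, so it suffices to find which of them sends
  \<open>w @ [a]\<close> to \<open>B (w @ [a])\<close>.\<close>

lemma log_rep_snoc:
  "log_rep A B (w @ [a]) =
     log_rep A B w + of_bool (log_output (log_state_at A B w) a) * 2 ^ length w"
proof -
  let ?d = "log_rep A B w"
  let ?\<beta> = "section_at B w" and ?\<gamma> = "section_at (A ^^ ?d) w"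
  have B_snoc: "B (w @ [a]) = B w @ ?\<beta> [a]"
    using tree_endo_section_at[OF endo] .
  have A_snoc: "(A ^^ ?d) (w @ [b]) = B w @ ?\<gamma> [b]" for b
    using tree_endo_section_at[OF endo_funpow, of ?d w] log_rep by simp
  show ?thesis
  proof (cases "?\<beta> [a] = ?\<gamma> [a]")
    case True
    then have "log_rep A B (w @ [a]) = ?d"
      using log_rep(1)[of w] A_snoc B_snoc by (intro log_rep_eqI) auto
    then show ?thesis
      using True by (simp add: log_state_at_def log_output_def)
  next
    case False
    have "(A ^^ ?d) (w @ [a]) \<noteq> (A ^^ ?d) (w @ [\<not> a])"
      using inj_fn[OF bij_is_inj[OF tree_auto_bij[OF auto]], of ?d] by (simp add: inj_eq)
    then have "?\<gamma> [a] \<noteq> ?\<gamma> [\<not> a]"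
      using A_snoc by auto
    moreover have "length (?\<gamma> [b]) = 1" "length (?\<beta> [b]) = 1" for b
      by (simp_all add: section_at_def length_funpow length_B)
    \<comment> \<open>Only two letters exist; this is used with \<open>t\<close> as
      \<open>?\<gamma> [a]\<close>, the value avoided by both \<open>?\<gamma> [\<not> a]\<close>
      and \<open>?\<beta> [a]\<close>.\<close>
    moreover have "u = v" if "length u = 1" "length v = 1" "u \<noteq> t" "v \<noteq> t" "length t = 1"
      for t u v :: "bool list"
      using that by (auto simp: length_Suc_conv)
    ultimately have "?\<gamma> [\<not> a] = ?\<beta> [a]"
      using False by metis
    \<comment> \<open>The power \<open>2 ^ length w\<close> acts first and flips the last letter;
      then \<open>A ^^ ?d\<close> produces the required letter.\<close>
    then have "(A ^^ (?d + 2 ^ length w)) (w @ [a]) = B (w @ [a])"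
      using A_snoc B_snoc funpow_period_snoc by (simp add: funpow_add)
    then have "log_rep A B (w @ [a]) = ?d + 2 ^ length w"
      using log_rep(1)[of w] by (intro log_rep_eqI) auto
    then show ?thesis
      using False by (simp add: log_state_at_def log_output_def)
  qed
qed

text \<open>The inner power fixes \<open>w\<close>, so the chain rule takes both sections at
  \<open>w\<close>. This explains the products \<open>\<gamma> \<circ> \<delta>\<close> and
  \<open>\<delta> \<circ> \<delta>\<close> in \<open>log_transition\<close>.\<close>

lemma section_funpow_add_period:
  "section_at (A ^^ (k + 2 ^ length w)) w =
     section_at (A ^^ k) w \<circ> section_at (A ^^ (2 ^ length w)) w"
  using section_at_comp[OF endo_funpow endo_funpow, of k "2 ^ length w" w]
  by (simp add: funpow_add funpow_period)

lemma log_transition_state_at: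
  "log_transition (log_state_at A B w) a = log_state_at A B (w @ [a])"
proof -
  let ?\<delta> = "section_at (A ^^ (2 ^ length w)) w"
  have "section_at (A ^^ (2 ^ length (w @ [a]))) (w @ [a]) = section_at (?\<delta> \<circ> ?\<delta>) [a]"
    using section_funpow_add_period[of "2 ^ length w" w]
    by (simp add: section_at_append mult_2)
  moreover have "section_at (A ^^ log_rep A B (w @ [a])) (w @ [a]) =
    (if section_at B w [a] = section_at (A ^^ log_rep A B w) w [a]
     then section_at (section_at (A ^^ log_rep A B w) w) [a]
     else section_at (section_at (A ^^ log_rep A B w) w \<circ> ?\<delta>) [a])"
    using section_funpow_add_period[of "log_rep A B w" w]
    by (simp add: log_rep_snoc log_state_at_def log_output_def section_at_append)
  ultimately show ?thesis
    unfolding log_state_at_def log_transition_def by (simp add: section_at_append)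
qed

lemma log_rep_Nil: "log_rep A B [] = 0"
  using log_rep(1)[of "[]"] by simp

lemma log_state_at_Nil: "log_state_at A B [] = (B, id, A)"
  by (simp add: log_state_at_def section_at_Nil log_rep_Nil)

lemma log_states_eq: "log_states A B = range (log_state_at A B)"
  by (auto simp: log_states_def log_state_at_def)

lemma mealy_automaton_log: "mealy_automaton (log_automaton A B)"
  unfolding mealy_automaton_def log_automaton_def log_states_eq
  by (auto simp: log_transition_state_at simp flip: log_state_at_Nil)

text \<open>The prefix \<open>u\<close> is arbitrary because after one letter the run continues from
  the state of \<open>u @ [a]\<close>, to which the induction hypothesis is applied.\<close>

lemma log_rep_append:
  "int (log_rep A B (u @ w)) = int (log_rep A B u) + 2 ^ length u *
     (\<Sum>i<length w. of_bool (output_word (log_automaton A B) (log_state_at A B u) w ! i) * 2 ^ i)"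
proof (induction w arbitrary: u)
  case (Cons a w)
  let ?out = "output_word (log_automaton A B)"
  let ?b = "log_output (log_state_at A B u) a"
  let ?v = "?out (log_state_at A B (u @ [a])) w"
  have out: "?out (log_state_at A B u) (a # w) = ?b # ?v"
    by (simp add: log_automaton_def log_transition_state_at)
  have "int (log_rep A B (u @ a # w)) = int (log_rep A B ((u @ [a]) @ w))"
    by simp
  also have "\<dots> = int (log_rep A B u) + 2 ^ length u *
      (of_bool ?b + 2 * (\<Sum>i<length w. of_bool (?v ! i) * 2 ^ i))"
    unfolding Cons.IH log_rep_snoc by (simp add: algebra_simps del: sum_mult_of_bool_eq)
  \<comment> \<open>The first output letter is the digit at index 0; the factor 2 moves the
    remaining digits up by one place.\<close>
  also have "of_bool ?b + 2 * (\<Sum>i<length w. of_bool (?v ! i) * 2 ^ i) =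
      (\<Sum>i<length (a # w). of_bool ((?b # ?v) ! i) * 2 ^ i :: int)"
    unfolding length_Cons sum.lessThan_Suc_shift sum_distrib_left
    by (simp add: mult.left_commute del: sum_mult_of_bool_eq)
  finally show ?case
    unfolding out .
qed simp

end

theorem theorem6p3:
  fixes A B :: "bool list \<Rightarrow> bool list"
    and MA :: "('s, bool) mealy" and MB :: "('t, bool) mealy"
  assumes "tree_auto A"
    and "finite_mealy_automaton MA" and "A = mealy_map MA"
    and "bounded_activity A"
    and "\<forall>n. level_transitive A n"
    and "tree_endo B"
    and "finite_mealy_automaton MB" and "B = mealy_map MB"
  shows "mealy_automaton (log_automaton A B) \<and>
    (\<forall>n w. length w = n \<longrightarrow>
       Log A n B w =
         ZMod (2 ^ n) (\<Sum>i<n. of_bool (mealy_map (log_automaton A B) w ! i) * 2 ^ i))"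
proof -
  interpret level_transitive_pair A B
    using assms(1,5,6) by unfold_locales auto
  have "int (log_rep A B w) =
      (\<Sum>i<length w. of_bool (mealy_map (log_automaton A B) w ! i) * 2 ^ i)" for w
    \<comment> \<open>The empty prefix has exponent 0 and the initial state.\<close>
    using log_rep_append[of "[]" w]
    by (simp add: mealy_map_def log_rep_Nil log_state_at_Nil log_automaton_def)
  then show ?thesis
    using mealy_automaton_log Log_eq by auto
qed

end
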